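(* Let $k\ge 1$ and $t\ge 0$ be integers (no upper bound on $t$ in terms of $k$ is assumed). Let $y_{k;t}(z)$ be the generating function of $k_t$-Dyck paths by length, i.e. the coefficient of $z^N$ in $y_{k;t}(z)$ is the number of $k_t$-Dyck paths of length $N$. Then, as formal power series, $$y_{k;t}(z)=\left(\sum_{0\le \ell\le t/k}(-1)^\ell\binom{t-k\ell}{\ell}z^{(k+1)\ell}\right) y_k(z)^{t+1}.$$ Equivalently, for every integer $n\ge 0$ the number of $k_t$-Dyck paths of length $(k+1)n$ is $$\sum_{0\le \ell\le t/k}(-1)^\ell\binom{t-k\ell}{\ell}\,\frac{t+1}{(k+1)(n-\ell)+t+1}\binom{(k+1)(n-\ell)+t+1}{n-\ell},$$ where the terms with $\ell>n$ are taken to be $0$.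
   Context: A $k_t$-Dyck path of length $N$ is a lattice path with $N$ steps, each being an up-step (raising the level by $1$) or a down-step (lowering the level by $k$), which starts at level $0$, ends at level $0$, and never goes below level $-t$. (Such a path can exist only if $N$ is a multiple of $k+1$.) The case $t=0$ gives the $k$-Dyck paths. The series $y_k(z)$ is the generating function of $k$-Dyck paths by length; it is the unique formal power series satisfying $y_k=1+z^{k+1}y_k^{k+1}$. Summation index $\ell$ runs over integers; $\binom{a}{b}$ is the usual binomial coefficient, equal to $0$ if $0\le a<b$. *)

theory Defs
  imports "HOL-Computational_Algebra.Formal_Power_Series"
begin

datatype step = Up | Down

fun rise :: "nat \<Rightarrow> step \<Rightarrow> int" where
  "rise k Up = 1"
| "rise k Down = - int k"

definition level :: "nat \<Rightarrow> step list \<Rightarrow> nat \<Rightarrow> int" where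
  "level k p i = sum_list (map (rise k) (take i p))"

definition dyck_paths :: "nat \<Rightarrow> nat \<Rightarrow> nat \<Rightarrow> step list set" where
  "dyck_paths k t N =
     {p. length p = N \<and> level k p N = 0 \<and> (\<forall>i\<le>N. - int t \<le> level k p i)}"

definition dyck_gf :: "nat \<Rightarrow> nat \<Rightarrow> int fps" where
  "dyck_gf k t = Abs_fps (\<lambda>N. int (card (dyck_paths k t N)))"

abbreviation yk :: "nat \<Rightarrow> int fps" where
  "yk k \<equiv> dyck_gf k 0"

end

theory Submission
  imports Defs
begin

text \<open>
  Raising every level by \<open>t\<close> turns a \<open>k\<^sub>t\<close>-Dyck path into a walk from \<open>t\<close> to \<open>t\<close> that stays on
  the natural numbers. Keep the target \<open>t\<close> fixed, let the start \<open>h\<close> vary, and write \<open>W\<^sub>h\<close> for the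
  generating function of the walks from \<open>h\<close> to \<open>t\<close>. Splitting off the first step gives
  \<open>W\<^sub>h = [h = t] + X (W\<^bsub>h+1\<^esub> + W\<^bsub>h-k\<^esub>)\<close>, where the last term is present only if \<open>h \<ge> k\<close>.

  For \<open>h < t\<close> the inhomogeneous term vanishes, so the equation can be solved for \<open>W\<^bsub>h+1\<^esub>\<close>: all of
  \<open>W\<^sub>1, \<dots>, W\<^sub>t\<close> are multiples of \<open>W\<^sub>0\<close>, and \<open>X\<^sup>h W\<^sub>h = P\<^sub>h W\<^sub>0\<close> where \<open>P\<^sub>0 = 1\<close> and
  \<open>P\<^bsub>h+1\<^esub> = P\<^sub>h - X\<^bsup>k+1\<^esup> P\<^bsub>h-k\<^esub>\<close> (\<open>walk_gf_from_below\<close>). By Pascal's rule this recurrence is solved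
  by the alternating binomial sum of the theorem (\<open>start_poly_Suc\<close>).

  A walk from \<open>0\<close> to \<open>t\<close> climbs by unit steps, hence it is cut by its last visits to
  \<open>0, 1, \<dots>, t - 1\<close> into \<open>t + 1\<close> shifted \<open>k\<close>-Dyck paths joined by \<open>t\<close> up-steps, so
  \<open>W\<^sub>0 = X\<^sup>t y\<^bsup>t+1\<^esup>\<close> (\<open>walk_gf_from_0\<close>). Taking \<open>h = t\<close> and cancelling \<open>X\<^sup>t\<close> gives
  \<open>W\<^sub>t = P\<^sub>t y\<^bsup>t+1\<^esup>\<close>, the identity of power series.

  For the explicit count, the last step of a nonempty \<open>k\<close>-Dyck path starts at level \<open>k\<close>, so
  \<open>y = 1 + X W\<close> with \<open>W\<close> counting the walks from \<open>0\<close> to \<open>k\<close>, that is \<open>y = 1 + X\<^bsup>k+1\<^esup> y\<^bsup>k+1\<^esup>\<close>.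
  Multiplied by \<open>y\<^sup>m\<close> this is a recurrence which determines the coefficients of all powers of
  \<open>y\<close>, and the ballot numbers satisfy it (\<open>ballot_recurrence\<close>, \<open>yk_power_nth\<close>).
\<close>

unbundle fps_syntax

section \<open>Walks on the natural numbers\<close>

definition walks :: "nat \<Rightarrow> nat \<Rightarrow> nat \<Rightarrow> nat \<Rightarrow> step list set" where
  "walks k t n h = {p. length p = n \<and> int h + level k p n = int t \<and> (\<forall>i\<le>n. 0 \<le> int h + level k p i)}"

definition walk_gf :: "nat \<Rightarrow> nat \<Rightarrow> nat \<Rightarrow> int fps" where
  "walk_gf k t h = Abs_fps (\<lambda>n. int (card (walks k t n h)))"

lemma dyck_gf_eq_walk_gf: "dyck_gf k t = walk_gf k t t"
proof -
  have "dyck_paths k t n = walks k t n t" for n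
    by (auto simp: dyck_paths_def walks_def algebra_simps)
  then show ?thesis
    by (simp add: dyck_gf_def walk_gf_def)
qed

lemma level_0 [simp]: "level k p 0 = 0"
  by (simp add: level_def)

lemma level_Cons [simp]: "level k (s # p) (Suc i) = rise k s + level k p i"
  by (simp add: level_def)

lemma all_le_Suc_iff: "(\<forall>i\<le>Suc n. P i) \<longleftrightarrow> P 0 \<and> (\<forall>i\<le>n. P (Suc i))"
  using All_less_Suc2[of "Suc n" P] by (simp only: less_Suc_eq_le)

lemma walks_0: "walks k t 0 h = (if h = t then {[]} else {})"
  by (auto simp: walks_def)

lemma Up_Cons_in_walks: "Up # p \<in> walks k t (Suc n) h \<longleftrightarrow> p \<in> walks k t n (Suc h)"
  by (auto simp: walks_def all_le_Suc_iff algebra_simps)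

lemma Down_Cons_in_walks:
  "Down # p \<in> walks k t (Suc n) h \<longleftrightarrow> k \<le> h \<and> p \<in> walks k t n (h - k)"
proof (cases "k \<le> h")
  case True
  then show ?thesis
    by (auto simp: walks_def all_le_Suc_iff of_nat_diff algebra_simps)
next
  case False
  then have "\<not> 0 \<le> int h + level k (Down # p) (Suc 0)"
    by simp
  then show ?thesis
    using False by (auto simp: walks_def simp del: level_Cons)
qed

lemma walks_Suc:
  "walks k t (Suc n) h =
     Cons Up ` walks k t n (Suc h) \<union> (if k \<le> h then Cons Down ` walks k t n (h - k) else {})"
proof (rule set_eqI)
  fix p
  show "p \<in> walks k t (Suc n) h \<longleftrightarrow> p \<in> Cons Up ` walks k t n (Suc h) \<union>
          (if k \<le> h then Cons Down ` walks k t n (h - k) else {})"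
  proof (cases p)
    case Nil
    then show ?thesis by (auto simp: walks_def)
  next
    case (Cons s q)
    then show ?thesis
      by (cases s) (auto simp: Up_Cons_in_walks Down_Cons_in_walks)
  qed
qed

lemma finite_walks: "finite (walks k t n h)"
  by (induction n arbitrary: h) (auto simp: walks_0 walks_Suc)

lemma card_walks_Suc:
  "card (walks k t (Suc n) h) =
     card (walks k t n (Suc h)) + (if k \<le> h then card (walks k t n (h - k)) else 0)"
proof -
  have "Cons Up ` A \<inter> Cons Down ` B = {}" for A B
    by auto
  then show ?thesis
    by (simp add: walks_Suc card_Un_disjoint finite_walks card_image)
qed

lemma walk_gf_first_step:
  "walk_gf k t h = (if h = t then 1 else 0) +
     fps_X * (walk_gf k t (Suc h) + (if k \<le> h then walk_gf k t (h - k) else 0))"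
proof (rule fps_ext)
  fix n
  show "walk_gf k t h $ n = ((if h = t then 1 else 0) +
     fps_X * (walk_gf k t (Suc h) + (if k \<le> h then walk_gf k t (h - k) else 0))) $ n"
    by (cases n) (auto simp: walk_gf_def walks_0 card_walks_Suc)
qed

text \<open>The factor \<open>X\<close> makes the coefficients of degree \<open>n + 1\<close> depend only on those of degree \<open>n\<close>.
  This lemma replaces bijections: the decompositions of walks by their last step and by their last
  passage through a level are proved by checking that the claimed generating function, as a
  function of the starting level, solves the same system.\<close>

lemma first_step_unique:
  fixes A B c :: "nat \<Rightarrow> int fps"
  assumes "\<And>h. A h = c h + fps_X * (A (Suc h) + (if k \<le> h then A (h - k) else 0))"
    and "\<And>h. B h = c h + fps_X * (B (Suc h) + (if k \<le> h then B (h - k) else 0))"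
  shows "A h = B h"
proof (rule fps_ext)
  fix n
  show "A h $ n = B h $ n"
  proof (induction n arbitrary: h)
    case 0
    show ?case
      by (subst assms(1), subst assms(2)) simp
  next
    case (Suc n)
    show ?case
      by (subst assms(1), subst assms(2)) (simp add: Suc)
  qed
qed

lemma walk_gf_last_step:
  "walk_gf k t h = (if h = t then 1 else 0) +
     fps_X * ((if t = 0 then 0 else walk_gf k (t - 1) h) + walk_gf k (t + k) h)"
proof -
  define B where "B h = (if h = t then 1 else 0) +
     fps_X * ((if t = 0 then 0 else walk_gf k (t - 1) h) + walk_gf k (t + k) h)" for h
  have "walk_gf k t h = B h"
  proof (rule first_step_unique[where k = k and c = "\<lambda>h. if h = t then 1 else 0"])
    fix h
    show "walk_gf k t h = (if h = t then 1 else 0) +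
        fps_X * (walk_gf k t (Suc h) + (if k \<le> h then walk_gf k t (h - k) else 0))"
      by (rule walk_gf_first_step)
    have "(if t = 0 then 0 else walk_gf k (t - 1) h) + walk_gf k (t + k) h
        = B (Suc h) + (if k \<le> h then B (h - k) else 0)"
      unfolding B_def
      by (subst walk_gf_first_step[of k "t - 1" h], subst walk_gf_first_step[of k "t + k" h])
         (auto simp: algebra_simps)
    then show "B h = (if h = t then 1 else 0) +
        fps_X * (B (Suc h) + (if k \<le> h then B (h - k) else 0))"
      by (simp add: B_def)
  qed
  then show ?thesis
    by (simp add: B_def)
qed

section \<open>Walks from level 0\<close>

text \<open>A walk that ends at \<open>t + 1\<close> and visits level \<open>t\<close> or below cannot jump upwards over \<open>t\<close>.
  It is therefore a walk to \<open>t\<close> (up to its last visit there), an up-step, and a \<open>k\<close>-Dyck path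
  raised to level \<open>t + 1\<close>. The second summand counts the walks that stay above \<open>t\<close>
  all the time.\<close>

lemma walk_gf_last_passage:
  "walk_gf k (Suc t) h =
     fps_X * walk_gf k 0 0 * walk_gf k t h + (if t < h then walk_gf k 0 (h - Suc t) else 0)"
proof (rule first_step_unique[where k = k and A = "walk_gf k (Suc t)" and
      B = "\<lambda>h. fps_X * walk_gf k 0 0 * walk_gf k t h +
        (if t < h then walk_gf k 0 (h - Suc t) else 0)" and
      c = "\<lambda>h. if h = Suc t then 1 else 0"])
  fix h
  show "walk_gf k (Suc t) h = (if h = Suc t then 1 else 0) +
      fps_X * (walk_gf k (Suc t) (Suc h) + (if k \<le> h then walk_gf k (Suc t) (h - k) else 0))"
    by (rule walk_gf_first_step)
  let ?y = "walk_gf k 0 0"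
  let ?E = "\<lambda>h. if t < h then walk_gf k 0 (h - Suc t) else 0"
  have E: "?E h + (if h = t then fps_X * ?y else 0) = (if h = Suc t then 1 else 0) +
      fps_X * (?E (Suc h) + (if k \<le> h then ?E (h - k) else 0))"
  proof (cases "t < h")
    case True
    define d where "d = h - Suc t"
    have "?E h = walk_gf k 0 d" "h \<noteq> t" "h = Suc t \<longleftrightarrow> d = 0"
        "?E (Suc h) = walk_gf k 0 (Suc d)"
        "(if k \<le> h then ?E (h - k) else 0) = (if k \<le> d then walk_gf k 0 (d - k) else 0)"
      using True by (auto simp: d_def Suc_diff_Suc add.commute)
    then show ?thesis
      by (simp only: if_False add_0_right) (rule walk_gf_first_step)
  next
    case False
    then show ?thesis by auto
  qed
  \<comment> \<open>The summand \<open>?A\<close> has source \<open>X y\<close> at level \<open>t\<close>. In \<open>?E\<close>, which is cut off below \<open>t + 1\<close>,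
    the system would demand \<open>X ?E (t + 1) = X y\<close> at level \<open>t\<close>, where \<open>?E\<close> is \<open>0\<close>: the two
    discrepancies cancel in the sum.\<close>
  let ?A = "\<lambda>h. fps_X * ?y * walk_gf k t h"
  have A: "?A h = (if h = t then fps_X * ?y else 0) +
      fps_X * (?A (Suc h) + (if k \<le> h then ?A (h - k) else 0))"
    by (subst walk_gf_first_step) (auto simp: algebra_simps)
  have split: "(if k \<le> h then ?A (h - k) + ?E (h - k) else 0) =
      (if k \<le> h then ?A (h - k) else 0) + (if k \<le> h then ?E (h - k) else 0)"
    by simp
  have "?A h + ?E h = fps_X * (?A (Suc h) + (if k \<le> h then ?A (h - k) else 0)) +
      (?E h + (if h = t then fps_X * ?y else 0))"
    by (subst A) (simp only: add_ac)
  also have "\<dots> = (if h = Suc t then 1 else 0) + fps_X * (?A (Suc h) + ?E (Suc h) +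
        (if k \<le> h then ?A (h - k) + ?E (h - k) else 0))"
    unfolding E split by (simp only: distrib_left add_ac)
  finally show "?A h + ?E h = (if h = Suc t then 1 else 0) + fps_X * (?A (Suc h) + ?E (Suc h) +
        (if k \<le> h then ?A (h - k) + ?E (h - k) else 0))" .
qed

lemma walk_gf_from_0: "walk_gf k t 0 = fps_X ^ t * yk k ^ (t + 1)"
  by (induction t) (simp_all add: dyck_gf_eq_walk_gf walk_gf_last_passage)

text \<open>The last step of a nonempty \<open>k\<close>-Dyck path must be a down-step from level \<open>k\<close>.\<close>

lemma yk_eq: "yk k = 1 + fps_X ^ (k + 1) * yk k ^ (k + 1)"
proof -
  have "yk k = 1 + fps_X * walk_gf k k 0"
    using walk_gf_last_step[of k 0 0] by (simp add: dyck_gf_eq_walk_gf)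
  also have "\<dots> = 1 + fps_X ^ (k + 1) * yk k ^ (k + 1)"
    by (simp only: walk_gf_from_0) simp
  finally show ?thesis .
qed

section \<open>Walks from an arbitrary level below the target\<close>

text \<open>The polynomial \<open>P\<^sub>h\<close> of the introduction. Its generating function in \<open>h\<close> is
  \<open>1 / (1 - u + X\<^bsup>k+1\<^esup> u\<^bsup>k+1\<^esup>)\<close>.\<close>

definition start_poly :: "nat \<Rightarrow> nat \<Rightarrow> int fps" where
  "start_poly k h =
     (\<Sum>l = 0..h div k. fps_const ((-1) ^ l * int ((h - k * l) choose l)) * fps_X ^ ((k + 1) * l))"

text \<open>Adding vanishing terms to the sum lets both sides of the recurrence below be
  summed over the same range.\<close>

lemma start_poly_upto:
  assumes "k \<ge> 1" "h \<le> m"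
  shows "start_poly k h =
     (\<Sum>l\<le>m. fps_const ((-1) ^ l * int ((h - k * l) choose l)) * fps_X ^ ((k + 1) * l))"
  unfolding start_poly_def
proof (rule sum.mono_neutral_left)
  show "{0..h div k} \<subseteq> {..m}"
    using assms by (auto intro: order_trans[OF _ order_trans[OF div_le_dividend]])
  have "(h - k * l) choose l = 0" if "h div k < l" for l
  proof -
    have "h < k * l"
      using that assms by (simp add: div_less_iff_less_mult mult.commute)
    then show ?thesis
      using that by (simp add: binomial_eq_0)
  qed
  then show "\<forall>l\<in>{..m} - {0..h div k}.
      fps_const ((-1) ^ l * int ((h - k * l) choose l)) * fps_X ^ ((k + 1) * l) = 0"
    by auto
qed simp

lemma start_poly_0: "start_poly k 0 = 1"
  by (simp add: start_poly_def)

text \<open>Pascal's rule, summand by summand: the index \<open>l + 1\<close> of \<open>h + 1\<close> receives the index \<open>l + 1\<close>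
  of \<open>h\<close> and, because \<open>h - k (l + 1) = (h - k) - k l\<close>, the index \<open>l\<close> of \<open>h - k\<close>.
  If \<open>k (l + 1) > h\<close>, truncated subtraction makes Pascal's rule fail, but then all three
  contributions vanish.\<close>

lemma start_poly_Suc:
  assumes "k \<ge> 1"
  shows "start_poly k (Suc h) =
     start_poly k h - (if k \<le> h then fps_X ^ (k + 1) * start_poly k (h - k) else 0)"
proof -
  let ?f = "\<lambda>h l. fps_const ((-1) ^ l * int ((h - k * l) choose l)) * fps_X ^ ((k + 1) * l) :: int fps"
  have step: "?f (Suc h) (Suc l) =
      ?f h (Suc l) - (if k \<le> h then fps_X ^ (k + 1) * ?f (h - k) l else 0)" for l
  proof (cases "k * Suc l \<le> h")
    case True
    then have "k \<le> h" "Suc h - k * Suc l = Suc (h - k * Suc l)" "h - k - k * l = h - k * Suc l"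
      by (auto simp: Suc_diff_le)
    moreover have "fps_const ((-1) ^ Suc l * int (Suc (h - k * Suc l) choose Suc l)) =
        fps_const ((-1) ^ Suc l * int ((h - k * Suc l) choose Suc l)) -
        fps_const ((-1) ^ l * int ((h - k * Suc l) choose l))"
      unfolding fps_const_sub by (rule arg_cong[of _ _ fps_const]) (simp add: algebra_simps)
    moreover have "fps_X ^ ((k + 1) * Suc l) = fps_X ^ (k + 1) * (fps_X ^ ((k + 1) * l) :: int fps)"
      by (simp only: mult_Suc_right power_add)
    ultimately show ?thesis
      by (simp only: if_True left_diff_distrib right_diff_distrib mult.left_commute)
  next
    case False
    then have "(Suc h - k * Suc l) choose Suc l = 0" "(h - k * Suc l) choose Suc l = 0"
      by (auto simp: binomial_eq_0)
    moreover have "(h - k - k * l) choose l = 0" if "k \<le> h"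
    proof -
      have "l \<noteq> 0" "h - k - k * l = 0"
        using False that by (auto intro: gr0I)
      then show ?thesis
        by (simp add: binomial_eq_0)
    qed
    ultimately show ?thesis
      by (cases "k \<le> h") (simp_all only: if_True if_False of_nat_0 mult_zero_right
          mult_zero_left fps_const_0_eq_0 diff_zero)
  qed
  have "start_poly k (Suc h) = ?f (Suc h) 0 + (\<Sum>l\<le>h. ?f (Suc h) (Suc l))"
    by (simp only: start_poly_upto[OF assms order_refl] sum.atMost_Suc_shift)
  also have "\<dots> = ?f h 0 + (\<Sum>l\<le>h. ?f h (Suc l)) -
      (if k \<le> h then fps_X ^ (k + 1) * (\<Sum>l\<le>h. ?f (h - k) l) else 0)"
    by (simp only: step) (simp add: sum_subtractf sum_distrib_left)
  also have "?f h 0 + (\<Sum>l\<le>h. ?f h (Suc l)) = start_poly k h"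
    by (simp only: start_poly_upto[OF assms, of h "Suc h", OF le_SucI[OF order_refl]] sum.atMost_Suc_shift)
  also have "(\<Sum>l\<le>h. ?f (h - k) l) = start_poly k (h - k)"
    by (subst start_poly_upto[OF assms, of _ h]) simp_all
  finally show ?thesis .
qed

text \<open>Below the target the first-step equation has no source, so it can be solved for its next term
  as \<open>X W\<^bsub>g+1\<^esub> = W\<^sub>g - X W\<^bsub>g-k\<^esub>\<close>. After multiplication with \<open>X\<^sup>g\<close> this is the recurrence of
  \<open>start_poly\<close>.\<close>

lemma walk_gf_from_below:
  assumes "k \<ge> 1" "h \<le> t"
  shows "fps_X ^ h * walk_gf k t h = start_poly k h * walk_gf k t 0"
  using assms(2)
proof (induction h rule: less_induct)
  case (less h)
  show ?case
  proof (cases h)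
    case 0
    then show ?thesis
      by (simp add: start_poly_0)
  next
    case (Suc g)
    let ?W = "walk_gf k t"
    have "?W g = fps_X * (?W h + (if k \<le> g then ?W (g - k) else 0))"
      using less.prems Suc by (subst walk_gf_first_step) auto
    then have "fps_X ^ g * ?W g =
        fps_X ^ g * (fps_X * (?W h + (if k \<le> g then ?W (g - k) else 0)))"
      by simp
    then have "fps_X ^ h * ?W h =
        fps_X ^ g * ?W g - (if k \<le> g then fps_X ^ Suc g * ?W (g - k) else 0)"
      by (auto simp: Suc algebra_simps)
    also have "(if k \<le> g then fps_X ^ Suc g * ?W (g - k) else 0) =
        (if k \<le> g then fps_X ^ (k + 1) * (fps_X ^ (g - k) * ?W (g - k)) else 0)"
      by (simp add: mult.assoc[symmetric] power_add[symmetric])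
    also have "\<dots> = (if k \<le> g then fps_X ^ (k + 1) * (start_poly k (g - k) * ?W 0) else 0)"
      using less.IH[of "g - k"] less.prems Suc by simp
    also have "fps_X ^ g * ?W g = start_poly k g * ?W 0"
      using less.IH[of g] less.prems Suc by simp
    finally show ?thesis
      unfolding Suc start_poly_Suc[OF assms(1)] by (auto simp: algebra_simps)
  qed
qed

lemma dyck_gf_eq:
  assumes "k \<ge> 1"
  shows "dyck_gf k t = start_poly k t * yk k ^ (t + 1)"
proof -
  have "fps_X ^ t * dyck_gf k t = fps_X ^ t * (start_poly k t * yk k ^ (t + 1))"
    using walk_gf_from_below[OF assms order_refl, of t]
    by (simp only: dyck_gf_eq_walk_gf[of k t] walk_gf_from_0) (simp only: mult_ac)
  then show ?thesis
    by simp
qed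

section \<open>Coefficients\<close>

text \<open>With \<open>c m n = m / ((k + 1) n + m) * (((k + 1) n + m) choose n)\<close> this reads
  \<open>c (m + 1) (n + 1) = c m (n + 1) + c (m + k + 1) n\<close>; the upper entry of the last binomial is
  again \<open>s\<close>. All three binomials are rational multiples of \<open>s choose n\<close>, and what
  remains is \<open>(m + 1) s = m (s - n) + (m + k + 1) (n + 1)\<close>, which holds by the choice of \<open>s\<close>.\<close>

lemma ballot_recurrence:
  fixes k m n s :: nat
  assumes "s = (k + 1) * Suc n + m"
  shows "rat_of_nat (m + 1) / rat_of_nat (s + 1) * rat_of_nat ((s + 1) choose Suc n) =
     rat_of_nat m / rat_of_nat s * rat_of_nat (s choose Suc n) +
     rat_of_nat (m + k + 1) / rat_of_nat s * rat_of_nat (s choose n)"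
proof -
  define b where "b = rat_of_nat (s choose n)"
  have le: "n \<le> s"
    using assms by simp
  have 1: "rat_of_nat ((s + 1) choose Suc n) = rat_of_nat (s + 1) / rat_of_nat (Suc n) * b"
    using arg_cong[OF Suc_times_binomial_eq[of s n], of rat_of_nat]
    by (simp add: b_def field_simps)
  have "Suc n * (s choose Suc n) = (s - n) * (s choose n)"
    by (metis binomial_absorb_comp binomial_absorption mult.commute)
  from arg_cong[OF this, of rat_of_nat]
  have 2: "rat_of_nat (s choose Suc n) = (rat_of_nat s - rat_of_nat n) / rat_of_nat (Suc n) * b"
    using le by (simp add: b_def of_nat_diff field_simps)
  have pos: "rat_of_nat s \<noteq> 0" "rat_of_nat (Suc n) \<noteq> 0" "rat_of_nat (s + 1) \<noteq> 0"
    using assms by (simp_all del: of_nat_Suc of_nat_add)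
  have s: "rat_of_nat s = (rat_of_nat k + 1) * rat_of_nat (Suc n) + rat_of_nat m"
    using assms by (simp add: algebra_simps)
  have "rat_of_nat (m + 1) * rat_of_nat s =
      rat_of_nat m * (rat_of_nat s - rat_of_nat n) + rat_of_nat (m + k + 1) * rat_of_nat (Suc n)"
    unfolding s by (simp add: algebra_simps)
  then have "rat_of_nat (m + 1) / rat_of_nat (Suc n) =
      rat_of_nat m / rat_of_nat s * ((rat_of_nat s - rat_of_nat n) / rat_of_nat (Suc n))
        + rat_of_nat (m + k + 1) / rat_of_nat s"
    using pos by (simp add: field_simps del: of_nat_Suc of_nat_add)
  then have "rat_of_nat (m + 1) / rat_of_nat (Suc n) * b =
      (rat_of_nat m / rat_of_nat s * ((rat_of_nat s - rat_of_nat n) / rat_of_nat (Suc n))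
        + rat_of_nat (m + k + 1) / rat_of_nat s) * b"
    by simp
  moreover have "rat_of_nat (m + 1) / rat_of_nat (s + 1) * (rat_of_nat (s + 1) / rat_of_nat (Suc n) * b) =
      rat_of_nat (m + 1) / rat_of_nat (Suc n) * b"
    using pos(3) by (simp del: of_nat_Suc of_nat_add)
  ultimately show ?thesis
    unfolding 1 2 b_def[symmetric] by (simp only: distrib_right mult.assoc)
qed

text \<open>The equation of \<open>y\<close> gives \<open>y\<^bsup>m+1\<^esup> = y\<^sup>m + X\<^bsup>k+1\<^esup> y\<^bsup>m+k+1\<^esup>\<close>. On coefficients this is a recursion
  that lowers either \<open>n\<close> or the exponent, so induction on \<open>n\<close> and then on the exponent
  replaces Lagrange inversion.\<close>

lemma yk_power_nth:
  "rat_of_int ((yk k ^ Suc m) $ ((k + 1) * n)) =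
     rat_of_nat (Suc m) / rat_of_nat ((k + 1) * n + Suc m) * rat_of_nat (((k + 1) * n + Suc m) choose n)"
proof (induction n arbitrary: m)
  case 0
  have "yk k $ 0 = 1"
    by (subst yk_eq) simp
  then show ?case
    by (simp add: fps_nth_power_0 del: of_nat_Suc of_nat_add power_Suc)
next
  case (Suc n)
  note IH = Suc.IH
  have shift: "(yk k ^ (m + 1)) $ ((k + 1) * Suc n) =
      (yk k ^ m) $ ((k + 1) * Suc n) + (yk k ^ Suc (m + k)) $ ((k + 1) * n)" for m
  proof -
    have "yk k ^ (m + 1) = yk k ^ m * (1 + fps_X ^ (k + 1) * yk k ^ (k + 1))"
      using yk_eq[of k] by simp
    also have "\<dots> = yk k ^ m + fps_X ^ (k + 1) * yk k ^ Suc (m + k)"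
      by (simp add: algebra_simps power_add)
    finally show ?thesis
      by (simp only: fps_add_nth fps_X_power_mult_nth) simp
  qed
  let ?c = "\<lambda>m. rat_of_nat m / rat_of_nat ((k + 1) * Suc n + m) *
      rat_of_nat (((k + 1) * Suc n + m) choose Suc n)"
  \<comment> \<open>Starting at exponent \<open>0\<close> is possible because \<open>?c 0 = 0\<close> and \<open>(k + 1) * Suc n > 0\<close>.\<close>
  have "rat_of_int ((yk k ^ m) $ ((k + 1) * Suc n)) = ?c m" for m
  proof (induction m)
    case 0
    then show ?case by simp
  next
    case (Suc m)
    let ?s = "(k + 1) * Suc n + m"
    have s: "(k + 1) * n + Suc (m + k) = ?s"
      by simp
    have "rat_of_int ((yk k ^ Suc m) $ ((k + 1) * Suc n)) =
        rat_of_nat m / rat_of_nat ?s * rat_of_nat (?s choose Suc n) +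
        rat_of_nat (Suc (m + k)) / rat_of_nat ?s * rat_of_nat (?s choose n)"
      using Suc.IH IH[of "m + k"] shift[of m] unfolding s by (simp only: of_int_add Suc_eq_plus1)
    also have "\<dots> = ?c (Suc m)"
      using ballot_recurrence[OF refl, of m k n] by (simp only: Suc_eq_plus1 add_ac)
    finally show ?case .
  qed
  then show ?case .
qed

theorem mainTheorem1:
  fixes k t :: nat
  assumes "k \<ge> 1"
  shows "dyck_gf k t =
           (\<Sum>l = 0..t div k. fps_const ((-1) ^ l * int ((t - k * l) choose l)) * fps_X ^ ((k + 1) * l))
           * yk k ^ (t + 1)
         \<and> (\<forall>n :: nat. rat_of_nat (card (dyck_paths k t ((k + 1) * n))) =
           (\<Sum>l = 0..t div k.
              if l \<le> n
              then (-1) ^ l * rat_of_nat ((t - k * l) choose l)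
                   * (rat_of_nat (t + 1) / rat_of_nat ((k + 1) * (n - l) + t + 1))
                   * rat_of_nat (((k + 1) * (n - l) + t + 1) choose (n - l))
              else 0))"
proof (intro conjI allI)
  show gf: "dyck_gf k t =
      (\<Sum>l = 0..t div k. fps_const ((-1) ^ l * int ((t - k * l) choose l)) * fps_X ^ ((k + 1) * l))
      * yk k ^ (t + 1)"
    by (rule dyck_gf_eq[OF assms, unfolded start_poly_def])
  fix n :: nat
  let ?N = "(k + 1) * n"
  have term_nth: "rat_of_int ((fps_const ((-1) ^ l * int ((t - k * l) choose l)) * fps_X ^ ((k + 1) * l)
        * yk k ^ (t + 1)) $ ?N) =
      (if l \<le> n
       then (-1) ^ l * rat_of_nat ((t - k * l) choose l)
            * (rat_of_nat (t + 1) / rat_of_nat ((k + 1) * (n - l) + t + 1))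
            * rat_of_nat (((k + 1) * (n - l) + t + 1) choose (n - l))
       else 0)" for l
  proof -
    have iff: "?N < (k + 1) * l \<longleftrightarrow> \<not> l \<le> n"
      by (simp only: mult_less_cancel1 not_le add_gr_0 zero_less_one simp_thms)
    have diff: "?N - (k + 1) * l = (k + 1) * (n - l)"
      by (rule diff_mult_distrib2[symmetric])
    show ?thesis
      using yk_power_nth[of k t "n - l"]
      by (simp only: mult.assoc fps_mult_left_const_nth fps_X_power_mult_nth iff diff)
         (simp del: of_nat_Suc of_nat_add power_Suc mult_Suc_right mult_Suc)
  qed
  have "rat_of_nat (card (dyck_paths k t ?N)) = rat_of_int (dyck_gf k t $ ?N)"
    by (simp add: dyck_gf_def)
  also have "\<dots> = (\<Sum>l = 0..t div k. rat_of_int ((fps_const ((-1) ^ l * int ((t - k * l) choose l))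
      * fps_X ^ ((k + 1) * l) * yk k ^ (t + 1)) $ ?N))"
    by (simp only: gf sum_distrib_right fps_sum_nth of_int_sum)
  also have "\<dots> = (\<Sum>l = 0..t div k.
      if l \<le> n
      then (-1) ^ l * rat_of_nat ((t - k * l) choose l)
           * (rat_of_nat (t + 1) / rat_of_nat ((k + 1) * (n - l) + t + 1))
           * rat_of_nat (((k + 1) * (n - l) + t + 1) choose (n - l))
      else 0)"
    by (simp only: term_nth)
  finally show "rat_of_nat (card (dyck_paths k t ?N)) = \<dots>" .
qed

end
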